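(* Suppose that $P(\nu_i>c\mid X_i)\in(0,1)$ (a.s.) for some $c\in\mathbb{R}$ and that $\nu_i$ is independent of $(X_i,\alpha_i,\varepsilon_{i1},\varepsilon_{i2},\mu_i,\eta_{i1},\eta_{i2})$. Suppose further that either $P(E[\ddot Y_{i2}(0)-\ddot Y_{i1}(0)\mid\omega_i,X_i]>0)<1$ or $P(E[\ddot Y_{i2}(0)-\ddot Y_{i1}(0)\mid\omega_i,X_i]<0)<1$. Then the following are equivalent: (1) for every $g\in\mathcal{G}^x_\omega$ such that $G_i=g(X_i,\omega_i,\nu_i)$ satisfies $P(G_i=1\mid X_i)\in(0,1)$ (a.s.), conditional parallel trends holds, i.e. $$E[Y_{i2}(0)-Y_{i1}(0)\mid G_i=1,X_i]=E[Y_{i2}(0)-Y_{i1}(0)\mid G_i=0,X_i]\quad\text{a.s.};$$ (2) $E[\ddot Y_{i2}(0)-\ddot Y_{i1}(0)\mid\omega_i,X_i]=0$ almost surely.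
   Context: For a generic unit $i$ (i.i.d. across $i$) and $t\in\{1,2\}$, $X_{it}$ is a vector of covariates not affected by treatment and $X_i=(X_{i1},X_{i2})$. The untreated potential outcomes are real-valued with $Y_{it}(0)=\xi_t(X_{it},\alpha_i,\varepsilon_{it})$ for arbitrary (measurable) $\xi_t$, where $\alpha_i,\varepsilon_{i1},\varepsilon_{i2}$ are finite-dimensional random vectors; $\mu_i,\eta_{i1},\eta_{i2}$ are additional random vectors, $\nu_i$ a scalar random variable. All relevant moments exist (in particular $E|Y_{it}(0)|<\infty$). $\ddot Y_{it}(0)=Y_{it}(0)-E[Y_{it}(0)\mid X_i]$. $\omega_i$ is a given (measurable) function or subvector of $(\alpha_i,\varepsilon_{i1},\varepsilon_{i2},\mu_i,\eta_{i1},\eta_{i2})$. With $\mathcal{X},\mathcal{O},\mathcal{V}$ the supports of $X_i,\omega_i,\nu_i$, $\mathcal{G}^x_\omega$ is the class of all (measurable) functions $g:\mathcal{X}\times\mathcal{O}\times\mathcal{V}\to\{0,1\}$ and $G_i=g(X_i,\omega_i,\nu_i)$. For $d\in\{0,1\}$ with $P(G_i=d\mid X_i)>0$ a.s., $E[Z\mid G_i=d,X_i]=E[1\{G_i=d\}Z\mid X_i]/P(G_i=d\mid X_i)$. The distribution of covariates and unobservables is held fixed as $g$ varies. *)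

theory Defs
  imports "HOL-Probability.Probability"
begin

abbreviation gen_alg :: "'a measure \<Rightarrow> ('a \<Rightarrow> 'b::topological_space) \<Rightarrow> 'a measure" where
  "gen_alg M W \<equiv> vimage_algebra (space M) W borel"

definition cond_E :: "'a measure \<Rightarrow> ('a \<Rightarrow> 'b::topological_space) \<Rightarrow> ('a \<Rightarrow> real) \<Rightarrow> 'a \<Rightarrow> real" where
  "cond_E M W Z = real_cond_exp M (gen_alg M W) Z"

definition cond_P :: "'a measure \<Rightarrow> ('a \<Rightarrow> 'b::topological_space) \<Rightarrow> ('a \<Rightarrow> bool) \<Rightarrow> 'a \<Rightarrow> real" where
  "cond_P M W Q = cond_E M W (\<lambda>s. of_bool (Q s))"

text \<open>The conditional expectation of \<open>Z\<close> given \<open>G = d\<close> and \<open>X\<close>; it is meaningful only where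
  the denominator is positive.\<close>

definition cond_E_event :: "'a measure \<Rightarrow> ('a \<Rightarrow> nat) \<Rightarrow> nat \<Rightarrow> ('a \<Rightarrow> 'b::topological_space)
    \<Rightarrow> ('a \<Rightarrow> real) \<Rightarrow> 'a \<Rightarrow> real" where
  "cond_E_event M G d X Z =
     (\<lambda>s. cond_E M X (\<lambda>s'. of_bool (G s' = d) * Z s') s / cond_P M X (\<lambda>s'. G s' = d) s)"

definition demeaned :: "'a measure \<Rightarrow> ('a \<Rightarrow> 'b::topological_space) \<Rightarrow> ('a \<Rightarrow> real) \<Rightarrow> 'a \<Rightarrow> real" where
  "demeaned M X Y = (\<lambda>s. Y s - cond_E M X Y s)"

text \<open>Independence is stated on generated sigma-algebras because \<open>indep_var\<close> forces both
  random variables to have the same value type.\<close>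

definition independent_rvs :: "'a measure \<Rightarrow> ('a \<Rightarrow> 'b::topological_space)
    \<Rightarrow> ('a \<Rightarrow> 'c::topological_space) \<Rightarrow> bool" where
  "independent_rvs M V W =
     prob_space.indep_set M (sets (gen_alg M V)) (sets (gen_alg M W))"

definition rv_support :: "'a measure \<Rightarrow> ('a \<Rightarrow> 'b::topological_space) \<Rightarrow> 'b set" where
  "rv_support M W = {w. \<forall>U. open U \<and> w \<in> U \<longrightarrow> measure (distr M borel W) U > 0}"

text \<open>The measurable functions from the product of the three supports to \<open>{0, 1}\<close>. Functions on
  a subset are represented extensionally, that is, with the fixed value \<open>undefined\<close> off the
  supports; since \<open>(X, \<omega>, \<nu>)\<close> lies in the product of the supports almost surely, this
  value is immaterial for \<open>G\<close>.\<close>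

definition selection_class :: "'a measure \<Rightarrow> ('a \<Rightarrow> 'x::euclidean_space) \<Rightarrow> ('a \<Rightarrow> 'o::euclidean_space)
    \<Rightarrow> ('a \<Rightarrow> real) \<Rightarrow> ('x \<times> 'o \<times> real \<Rightarrow> nat) set" where
  "selection_class M X \<omega> \<nu> =
     (let S = rv_support M X \<times> rv_support M \<omega> \<times> rv_support M \<nu>
      in (S \<rightarrow>\<^sub>E {0, 1}) \<inter> measurable (restrict_space borel S) (count_space {0, 1}))"

definition cond_parallel_trends :: "'a measure \<Rightarrow> ('a \<Rightarrow> 'x::topological_space) \<Rightarrow> ('a \<Rightarrow> real)
    \<Rightarrow> ('a \<Rightarrow> real) \<Rightarrow> ('a \<Rightarrow> nat) \<Rightarrow> bool" where
  "cond_parallel_trends M X Y1 Y2 G \<longleftrightarrow>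
     (AE s in M. cond_E_event M G 1 X (\<lambda>s'. Y2 s' - Y1 s') s
               = cond_E_event M G 0 X (\<lambda>s'. Y2 s' - Y1 s') s)"

end

(* Let Z be the demeaned difference of the outcomes, h = E[Z | omega, X] and q = P(nu > c).
   Parallel trends for G is equivalent to E[1{G = 1} Z | X] = 0.  If h = 0, this follows by Fubini
   in nu, because 1{g(X, omega, v) = 1} is a function of (omega, X) for each fixed v.
   Conversely select by G = 1 iff h > 0 or nu > c.  Then E[1{G = 1} Z] = (1 - q) E[max h 0], since
   E h = 0, so parallel trends gives h <= 0 and thus h = 0.  The selection is admissible: on the
   X-event B where P(G = 1 | X) >= 1, independence forces h > 0, which contradicts
   E[1_B h] = E[1_B Z] = 0 unless B is null. *)

theory Submission
  imports Defs
begin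

section \<open>Topological supports of random vectors\<close>

lemma closed_rv_support: "closed (rv_support M W)"
proof -
  have "- rv_support M W = \<Union>{U. open U \<and> \<not> measure (distr M borel W) U > 0}"
    by (auto simp: rv_support_def)
  then have "open (- rv_support M W)"
    by auto
  then show ?thesis
    by (simp add: closed_def)
qed

text \<open>The complement of the support is the union of all open sets of probability zero. That
  union may be uncountable, but second countability (Lindelof) reduces it to a countable one, hence
  it is null.\<close>

lemma AE_in_rv_support:
  fixes W :: "'a \<Rightarrow> 'b::second_countable_topology"
  assumes "prob_space M" and W [measurable]: "W \<in> borel_measurable M"
  shows "AE s in M. W s \<in> rv_support M W"
proof -
  interpret prob_space M by fact
  define \<U> where "\<U> = {U. open U \<and> \<not> measure (distr M borel W) U > 0}"
  obtain \<V> where \<V>: "\<V> \<subseteq> \<U>" "countable \<V>" "\<Union>\<V> = \<Union>\<U>"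
    by (rule Lindelof[of \<U>]) (auto simp: \<U>_def)
  have "AE s in M. W s \<notin> U" if "U \<in> \<V>" for U
  proof -
    have U: "open U" "\<not> measure (distr M borel W) U > 0"
      using that \<V>(1) by (auto simp: \<U>_def)
    then have [measurable]: "U \<in> sets borel" by simp
    have "prob (W -` U \<inter> space M) = 0"
      using U by (simp add: measure_distr not_less measure_le_0_iff)
    then have "W -` U \<inter> space M \<in> null_sets M"
      by (simp add: emeasure_eq_measure null_setsI measurable_sets)
    then show ?thesis
      by (rule AE_I') auto
  qed
  then have "AE s in M. \<forall>U\<in>\<V>. W s \<notin> U"
    by (subst AE_ball_countable) (use \<V>(2) in auto)
  moreover have "- rv_support M W = \<Union>\<V>"
    unfolding \<V>(3) by (auto simp: rv_support_def \<U>_def)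
  ultimately show ?thesis
    by (auto elim!: eventually_mono)
qed

section \<open>Generated sigma-algebras and subalgebras\<close>

lemma borel_measurable_PairD:
  fixes f :: "'a \<Rightarrow> 'b::second_countable_topology \<times> 'c::second_countable_topology"
  assumes "f \<in> borel_measurable N"
  shows "(\<lambda>s. fst (f s)) \<in> borel_measurable N" "(\<lambda>s. snd (f s)) \<in> borel_measurable N"
  using assms by (simp_all add: borel_prod[symmetric])

lemma subalgebra_gen_alg:
  assumes "W \<in> borel_measurable M"
  shows "subalgebra M (gen_alg M W)"
  using assms by (auto simp: subalgebra_def sets_vimage_algebra2 measurable_sets)

lemma gen_alg_measurable: "W \<in> borel_measurable (gen_alg M W)"
  by (rule measurable_vimage_algebra1) auto

lemma subalgebra_gen_alg_mono:
  assumes "V \<in> borel_measurable (gen_alg M W)"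
  shows "subalgebra (gen_alg M W) (gen_alg M V)"
  using subalgebra_gen_alg[OF assms] by simp

lemma (in prob_space) sigma_finite_subalgebra_of_subalgebra:
  assumes "subalgebra M F"
  shows "sigma_finite_subalgebra M F"
  using assms
  by (intro finite_measure_subalgebra_is_sigma_finite finite_measure_subalgebra.intro
      finite_measure_subalgebra_axioms.intro) unfold_locales

section \<open>Integration against a variable that is independent of a subalgebra\<close>

locale independent_of_subalgebra = prob_space M
  for M :: "'a measure" and N :: "'a measure" and \<nu> :: "'a \<Rightarrow> real" +
  assumes subalg: "subalgebra M N"
    and \<nu>_measurable [measurable]: "\<nu> \<in> borel_measurable M"
    and indep: "\<And>A B. A \<in> sets N \<Longrightarrow> B \<in> sets borel \<Longrightarrow>
      prob (A \<inter> (\<nu> -` B \<inter> space M)) = prob A * prob (\<nu> -` B \<inter> space M)"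
begin

text \<open>In the application \<open>N\<close> is generated by the covariates and all unobservables
  other than \<open>\<nu>\<close>. Pairing \<open>\<nu> s\<close> with the state \<open>s\<close>
  itself, seen only through \<open>N\<close>, allows any \<open>N\<close>-measurable function as a
  function of the first coordinate without writing it in terms of the generating vector.\<close>

lemma measurable_pair_graph:
  "(\<lambda>s. (s, \<nu> s)) \<in> measurable M (N \<Otimes>\<^sub>M borel)"
proof (rule measurable_Pair)
  show "(\<lambda>s. s) \<in> measurable M N"
    using measurable_from_subalg[OF subalg measurable_ident] by (simp add: id_def)
qed simp

text \<open>Independence recast as a product law: by the hypothesis \<open>indep\<close> both
  measures agree on rectangles, and sigma-finiteness extends this to the product sigma-algebra. This
  makes Fubini available.\<close>

lemma distr_pair_graph:
  "restr_to_subalg M N \<Otimes>\<^sub>M distr M borel \<nu> = distr M (N \<Otimes>\<^sub>M borel) (\<lambda>s. (s, \<nu> s))"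
proof (rule pair_measure_eqI)
  interpret R: prob_space "restr_to_subalg M N"
    using subalg by (rule prob_space_restr_to_subalg) unfold_locales
  interpret V: prob_space "distr M borel \<nu>"
    by (rule prob_space_distr) simp
  show "sigma_finite_measure (restr_to_subalg M N)" "sigma_finite_measure (distr M borel \<nu>)"
    by unfold_locales
  show "sets (restr_to_subalg M N \<Otimes>\<^sub>M distr M borel \<nu>)
      = sets (distr M (N \<Otimes>\<^sub>M borel) (\<lambda>s. (s, \<nu> s)))"
    unfolding sets_distr
    by (intro sets_pair_measure_cong) (simp_all add: sets_restr_to_subalg[OF subalg])
next
  fix A B
  assume "A \<in> sets (restr_to_subalg M N)" and "B \<in> sets (distr M borel \<nu>)"
  then have A: "A \<in> sets N" and B [measurable]: "B \<in> sets borel"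
    by (simp_all add: sets_restr_to_subalg[OF subalg])
  have AM: "A \<in> sets M" "A \<subseteq> space M"
    using A subalg sets.sets_into_space by (auto simp: subalgebra_def)
  have "(\<lambda>s. (s, \<nu> s)) -` (A \<times> B) \<inter> space M = A \<inter> (\<nu> -` B \<inter> space M)"
    using AM by auto
  then show "emeasure (restr_to_subalg M N) A * emeasure (distr M borel \<nu>) B
      = emeasure (distr M (N \<Otimes>\<^sub>M borel) (\<lambda>s. (s, \<nu> s))) (A \<times> B)"
    using A AM indep[OF A B]
    by (simp add: emeasure_distr measurable_pair_graph emeasure_restr_to_subalg[OF subalg]
        emeasure_eq_measure ennreal_mult)
qed

lemma integral_independent:
  fixes f :: "'a \<times> real \<Rightarrow> real"
  assumes f: "f \<in> borel_measurable (N \<Otimes>\<^sub>M borel)"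
    and int: "integrable M (\<lambda>s. f (s, \<nu> s))"
  shows "(\<integral>s. f (s, \<nu> s) \<partial>M) = (\<integral>v. (\<integral>s. f (s, v) \<partial>M) \<partial>distr M borel \<nu>)"
proof -
  interpret R: prob_space "restr_to_subalg M N"
    using subalg by (rule prob_space_restr_to_subalg) unfold_locales
  interpret V: prob_space "distr M borel \<nu>"
    by (rule prob_space_distr) simp
  interpret pair_sigma_finite "restr_to_subalg M N" "distr M borel \<nu>" ..
  have *: "integrable (restr_to_subalg M N \<Otimes>\<^sub>M distr M borel \<nu>) (case_prod (curry f))"
    unfolding distr_pair_graph case_prod_curry
    using int by (simp add: integrable_distr_eq measurable_pair_graph f)
  have "(\<integral>s. f (s, \<nu> s) \<partial>M) = (\<integral>p. f p \<partial>distr M (N \<Otimes>\<^sub>M borel) (\<lambda>s. (s, \<nu> s)))"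
    by (rule integral_distr[symmetric, OF measurable_pair_graph f])
  also have "\<dots> = (\<integral>v. (\<integral>s. f (s, v) \<partial>restr_to_subalg M N) \<partial>distr M borel \<nu>)"
    using integral_snd[OF *] by (simp add: distr_pair_graph)
  \<comment> \<open>Every section at a fixed \<open>v\<close> is \<open>N\<close>-measurable, so the
    restricted measure can be replaced by \<open>M\<close>.\<close>
  also have "\<dots> = (\<integral>v. (\<integral>s. f (s, v) \<partial>M) \<partial>distr M borel \<nu>)"
    by (intro Bochner_Integration.integral_cong refl integral_subalgebra2[OF subalg])
      (use f in \<open>auto intro: measurable_compose[OF measurable_Pair2' f]\<close>)
  finally show ?thesis .
qed

text \<open>For a frozen value \<open>v\<close> the section of \<open>T\<close> lies in
  \<open>H\<close>, so under its indicator \<open>Z\<close> can be replaced by its conditional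
  expectation given \<open>H\<close>, which is zero. Integrating over \<open>v\<close> gives zero on
  every set of \<open>F\<close>. Here \<open>T\<close> stands for a selection event that depends on
  the state through \<open>H\<close> and on \<open>\<nu>\<close>.\<close>

lemma cond_exp_selected_eq_0:
  assumes F: "subalgebra H F" and H: "subalgebra N H"
    and Z: "integrable M Z" "Z \<in> borel_measurable N"
    and Z0: "AE s in M. real_cond_exp M H Z s = 0"
    and T: "T \<in> sets (H \<Otimes>\<^sub>M borel)"
  shows "AE s in M. real_cond_exp M F (\<lambda>s. indicator T (s, \<nu> s) * Z s) s = 0"
proof -
  have MH: "subalgebra M H" and MF: "subalgebra M F"
    using subalg H F by (auto simp: subalgebra_def)
  interpret H: sigma_finite_subalgebra M H
    by (rule sigma_finite_subalgebra_of_subalgebra[OF MH])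
  interpret F: sigma_finite_subalgebra M F
    by (rule sigma_finite_subalgebra_of_subalgebra[OF MF])
  have spaces: "space N = space M" "space H = space M" "space F = space M"
    using subalg MH MF by (auto simp: subalgebra_def)
  \<comment> \<open>\<open>T\<close> has to be lifted to the larger product, because the integrand
    also contains \<open>Z\<close>, which is measurable only for \<open>N\<close>.\<close>
  have HN: "(\<lambda>p. p) \<in> measurable (N \<Otimes>\<^sub>M borel) (H \<Otimes>\<^sub>M (borel :: real measure))"
    using measurable_from_subalg[OF H measurable_ident]
    by (intro measurable_pair) (auto simp: comp_def id_def intro: measurable_compose[OF measurable_fst])
  have TN [measurable]: "T \<in> sets (N \<Otimes>\<^sub>M borel)"
  proof -
    have "space (H \<Otimes>\<^sub>M (borel :: real measure)) = space (N \<Otimes>\<^sub>M (borel :: real measure))"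
      by (simp add: space_pair_measure spaces)
    then have "(\<lambda>p. p) -` T \<inter> space (N \<Otimes>\<^sub>M borel) = T"
      using sets.sets_into_space[OF T] by blast
    with measurable_sets[OF HN T] show ?thesis by (simp only:)
  qed
  have TM [measurable]: "(\<lambda>s. indicator T (s, \<nu> s) :: real) \<in> borel_measurable M"
    by (rule measurable_compose[OF measurable_pair_graph]) simp
  have [measurable]: "Z \<in> borel_measurable M" using Z by simp
  have int: "integrable M (\<lambda>s. indicator T (s, \<nu> s) * Z s)"
  proof (rule Bochner_Integration.integrable_bound[OF Z(1)])
    show "(\<lambda>s. indicator T (s, \<nu> s) * Z s) \<in> borel_measurable M" by measurable
  qed (auto simp: indicator_def)
  show ?thesis
  proof (rule F.real_cond_exp_charact)
    fix A assume A: "A \<in> sets F"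
    then have AH: "A \<in> sets H" using F by (auto simp: subalgebra_def)
    then have AN [measurable]: "A \<in> sets N" using H by (auto simp: subalgebra_def)
    have AM [measurable]: "A \<in> sets M" using AH MH by (auto simp: subalgebra_def)
    \<comment> \<open>The integrand with \<open>\<nu> s\<close> replaced by a free second
      coordinate; the original one is \<open>f\<close> along the graph of
      \<open>\<nu>\<close>.\<close>
    define f where "f = (\<lambda>p. indicator A (fst p) * (indicator T p * Z (fst p)) :: real)"
    have ZN [measurable]: "Z \<in> borel_measurable N" by fact
    have f: "f \<in> borel_measurable (N \<Otimes>\<^sub>M borel)"
      unfolding f_def by measurable
    have "(\<integral>s. f (s, v) \<partial>M) = 0" for v
    proof -
      have AT: "(\<lambda>s. indicator A s * indicator T (s, v) :: real) \<in> borel_measurable H"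
        using AH T by measurable
      have "integrable M (\<lambda>s. (indicator A s * indicator T (s, v)) * Z s)"
      proof (rule Bochner_Integration.integrable_bound[OF Z(1)])
        show "(\<lambda>s. (indicator A s * indicator T (s, v)) * Z s) \<in> borel_measurable M"
          by (rule borel_measurable_times[OF measurable_from_subalg[OF MH AT]]) measurable
      qed (auto simp: indicator_def)
      with AT have "(\<integral>s. (indicator A s * indicator T (s, v)) * Z s \<partial>M)
          = (\<integral>s. (indicator A s * indicator T (s, v)) * real_cond_exp M H Z s \<partial>M)"
        by (intro H.real_cond_exp_intg(2)[symmetric]) simp_all
      also have "\<dots> = 0"
        by (rule integral_eq_zero_AE, rule eventually_mono[OF Z0]) simp
      finally show ?thesis by (simp add: f_def ac_simps)
    qed
    moreover have "integrable M (\<lambda>s. f (s, \<nu> s))"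
      using integrable_mult_indicator[OF AM int] by (simp add: f_def)
    ultimately have "(\<integral>s. f (s, \<nu> s) \<partial>M) = 0"
      using integral_independent[OF f] by simp
    then show "(\<integral>s\<in>A. indicator T (s, \<nu> s) * Z s \<partial>M) = (\<integral>s\<in>A. 0 \<partial>M)"
      by (simp add: f_def set_lebesgue_integral_def)
  qed (simp_all add: int)
qed

text \<open>The tail event depends on \<open>\<nu>\<close> alone and \<open>Z\<close> on
  \<open>N\<close> alone, so the iterated integral factors. It is applied below to truncations of
  \<open>Z\<close> and to indicators in \<open>N\<close>.\<close>

lemma integral_tail_mult:
  assumes Z: "integrable M Z" "Z \<in> borel_measurable N"
  shows "(\<integral>s. of_bool (\<nu> s > c) * Z s \<partial>M) = prob {s \<in> space M. \<nu> s > c} * (\<integral>s. Z s \<partial>M)"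
proof -
  define f where "f = (\<lambda>p. of_bool (snd p > c) * Z (fst p) :: real)"
  have [measurable]: "Z \<in> borel_measurable M" using Z by simp
  have [measurable]: "Z \<in> borel_measurable N" by fact
  have "f \<in> borel_measurable (N \<Otimes>\<^sub>M borel)"
    unfolding f_def by measurable
  moreover have "integrable M (\<lambda>s. f (s, \<nu> s))"
    unfolding f_def by (rule Bochner_Integration.integrable_bound[OF Z(1)]) (auto simp: of_bool_def)
  ultimately have "(\<integral>s. f (s, \<nu> s) \<partial>M) = (\<integral>v. (\<integral>s. f (s, v) \<partial>M) \<partial>distr M borel \<nu>)"
    by (rule integral_independent)
  also have "\<dots> = (\<integral>v. indicator {c<..} v * (\<integral>s. Z s \<partial>M) \<partial>distr M borel \<nu>)"
    by (auto simp: f_def indicator_def intro!: Bochner_Integration.integral_cong)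
  also have "\<dots> = prob (\<nu> -` {c<..} \<inter> space M) * (\<integral>s. Z s \<partial>M)"
    by (simp add: measure_distr)
  also have "\<nu> -` {c<..} \<inter> space M = {s \<in> space M. \<nu> s > c}" by auto
  finally show ?thesis by (simp add: f_def)
qed

section \<open>The selection by \<open>h s > 0 \<or> \<nu> s > c\<close>\<close>

context
  fixes Z :: "'a \<Rightarrow> real" and H :: "'a measure" and h :: "'a \<Rightarrow> real" and c :: real
  assumes H: "subalgebra N H"
    and Z: "integrable M Z" "Z \<in> borel_measurable N"
    and h: "h = real_cond_exp M H Z"
    and tail: "prob {s \<in> space M. \<nu> s > c} < 1"
begin

lemma subalg_H: "subalgebra M H"
  using subalg H by (auto simp: subalgebra_def)

lemma h_measurable: "h \<in> borel_measurable H" "h \<in> borel_measurable N" "h \<in> borel_measurable M"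
proof -
  show "h \<in> borel_measurable H" unfolding h by simp
  then show "h \<in> borel_measurable N" "h \<in> borel_measurable M"
    using measurable_from_subalg[OF H] measurable_from_subalg[OF subalg_H] by auto
qed

text \<open>The selected event splits into \<open>h > 0\<close> and the part of the tail where
  \<open>h \<le> 0\<close>. With \<open>a\<close> the mean of \<open>Z\<close> on the first piece,
  its mean on \<open>h \<le> 0\<close> is \<open>- a\<close>, and independence scales this by the
  tail probability \<open>?q\<close>. The selected mean is therefore \<open>a * (1 - ?q)\<close>,
  and \<open>tail\<close> forces \<open>a = 0\<close>.\<close>

lemma cond_exp_eq_0_if_selected_mean_0:
  assumes mean: "(\<integral>s. Z s \<partial>M) = 0"
    and selected: "(\<integral>s. of_bool (h s > 0 \<or> \<nu> s > c) * Z s \<partial>M) = 0"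
  shows "AE s in M. h s = 0"
proof -
  interpret H: sigma_finite_subalgebra M H
    by (rule sigma_finite_subalgebra_of_subalgebra[OF subalg_H])
  note [measurable] = h_measurable Z(2)
  have [measurable]: "Z \<in> borel_measurable M" using Z by simp
  let ?q = "prob {s \<in> space M. \<nu> s > c}"
  have int_h: "integrable M h" "(\<integral>s. h s \<partial>M) = 0"
    using H.real_cond_exp_int[OF Z(1)] mean by (simp_all add: h)
  have int_pos: "integrable M (\<lambda>s. of_bool (h s > 0) * Z s)"
    by (rule Bochner_Integration.integrable_bound[OF Z(1)]) (auto simp: of_bool_def)
  have int_neg: "integrable M (\<lambda>s. of_bool (\<not> h s > 0) * Z s)"
    by (rule Bochner_Integration.integrable_bound[OF Z(1)]) (auto simp: of_bool_def)
  have int_tail: "integrable M (\<lambda>s. of_bool (\<nu> s > c) * (of_bool (\<not> h s > 0) * Z s))"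
    by (rule Bochner_Integration.integrable_bound[OF Z(1)]) (auto simp: of_bool_def)
  define a where "a = (\<integral>s. of_bool (h s > 0) * Z s \<partial>M)"
  have "a + (\<integral>s. of_bool (\<not> h s > 0) * Z s \<partial>M) = (\<integral>s. Z s \<partial>M)"
    unfolding a_def
    by (subst Bochner_Integration.integral_add[OF int_pos int_neg, symmetric])
      (auto intro!: Bochner_Integration.integral_cong simp: of_bool_def)
  then have neg: "(\<integral>s. of_bool (\<not> h s > 0) * Z s \<partial>M) = - a"
    using mean by simp
  have "(\<integral>s. of_bool (h s > 0 \<or> \<nu> s > c) * Z s \<partial>M)
      = a + (\<integral>s. of_bool (\<nu> s > c) * (of_bool (\<not> h s > 0) * Z s) \<partial>M)"
    unfolding a_def
    by (subst Bochner_Integration.integral_add[OF int_pos int_tail, symmetric])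
      (auto intro!: Bochner_Integration.integral_cong simp: of_bool_def)
  \<comment> \<open>\<open>Z\<close> cut to \<open>h \<le> 0\<close> is still
    \<open>N\<close>-measurable, since \<open>H\<close> is contained in \<open>N\<close>; so the
    tail factors out.\<close>
  also have "\<dots> = a + ?q * (- a)"
  proof -
    have "(\<lambda>s. of_bool (\<not> h s > 0) * Z s) \<in> borel_measurable N"
      by measurable
    then show ?thesis
      by (simp only: integral_tail_mult[OF int_neg] neg)
  qed
  finally have "a * (1 - ?q) = 0"
    using selected by (simp add: algebra_simps)
  then have "a = 0"
    using tail by simp
  \<comment> \<open>The weight is \<open>H\<close>-measurable, so \<open>h\<close> may replace
    \<open>Z\<close>; this identifies \<open>a\<close> as the mean of the positive part of
    \<open>h\<close>.\<close>
  moreover have "(\<integral>s. of_bool (h s > 0) * h s \<partial>M) = a"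
    unfolding a_def h
    by (rule H.real_cond_exp_intg(2)[OF int_pos[unfolded h]]) (use Z in auto)
  ultimately have int_hp: "(\<integral>s. of_bool (h s > 0) * h s \<partial>M) = 0"
    by simp
  have "integrable M (\<lambda>s. of_bool (h s > 0) * h s)"
    by (rule Bochner_Integration.integrable_bound[OF int_h(1)]) (auto simp: of_bool_def)
  then have "AE s in M. of_bool (h s > 0) * h s = 0"
    using int_hp by (subst (asm) integral_nonneg_eq_0_iff_AE) simp_all
  then have nonpos: "AE s in M. 0 \<le> - h s"
    by (auto simp: not_less elim!: eventually_mono split: if_splits)
  \<comment> \<open>A nonnegative function with zero integral vanishes almost everywhere;
    \<open>h\<close> has the same mean as \<open>Z\<close>.\<close>
  have "AE s in M. - h s = 0"
    using int_h nonpos by (subst integral_nonneg_eq_0_iff_AE[symmetric]) simp_all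
  then show ?thesis by simp
qed

text \<open>Positivity is inherited from the tail event, which is contained in the selection. For
  the upper bound, a set in \<open>F\<close> with no unselected mass must satisfy
  \<open>h > 0\<close> almost everywhere, because where \<open>h \<le> 0\<close> the independent
  \<open>\<nu>\<close> leaves a proportion \<open>1 - ?q > 0\<close> unselected. But
  \<open>h\<close> has mean zero over every set of \<open>F\<close>, so such a set is null.\<close>

lemma cond_prob_selection_strict:
  assumes F: "subalgebra H F"
    and Z0: "AE s in M. real_cond_exp M F Z s = 0"
    and pos: "AE s in M. real_cond_exp M F (\<lambda>s. of_bool (\<nu> s > c)) s > 0"
  shows "AE s in M. real_cond_exp M F (\<lambda>s. of_bool (h s > 0 \<or> \<nu> s > c)) s \<in> {0<..<1}"
proof -
  have MF: "subalgebra M F" and NF: "subalgebra N F"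
    using subalg_H H F by (auto simp: subalgebra_def)
  interpret H: sigma_finite_subalgebra M H
    by (rule sigma_finite_subalgebra_of_subalgebra[OF subalg_H])
  interpret F: sigma_finite_subalgebra M F
    by (rule sigma_finite_subalgebra_of_subalgebra[OF MF])
  note [measurable] = h_measurable Z(2)
  have [measurable]: "Z \<in> borel_measurable M" using Z by simp
  let ?Q = "\<lambda>s. of_bool (h s > 0 \<or> \<nu> s > c) :: real"
  let ?q = "prob {s \<in> space M. \<nu> s > c}"
  define p where "p = real_cond_exp M F ?Q"
  have int_Q: "integrable M ?Q"
    by (rule integrable_const_bound[of _ 1]) auto
  have int_tail: "integrable M (\<lambda>s. of_bool (\<nu> s > c) :: real)"
    by (rule integrable_const_bound[of _ 1]) auto
  have int_p: "integrable M p"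
    unfolding p_def by (rule F.real_cond_exp_int(1)[OF int_Q])
  have "AE s in M. real_cond_exp M F (\<lambda>s. of_bool (\<nu> s > c)) s \<le> p s"
    unfolding p_def by (rule F.real_cond_exp_mono[OF _ int_tail int_Q]) auto
  with pos have p_pos: "AE s in M. 0 < p s" by eventually_elim auto

  \<comment> \<open>The exact complement of the desired event \<open>p s < 1\<close>; no prior bound
    of \<open>p\<close> by one is needed.\<close>
  define B where "B = {s \<in> space M. p s \<ge> 1}"
  have "B = {s \<in> space F. p s \<ge> 1}"
    using MF by (simp add: B_def subalgebra_def)
  also have "\<dots> \<in> sets F"
    unfolding p_def by measurable
  finally have BF: "B \<in> sets F" .
  then have BH: "B \<in> sets H" and [measurable]: "B \<in> sets N" "B \<in> sets M"
    using F NF MF by (auto simp: subalgebra_def)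
  define U where "U = (\<lambda>s. indicator B s * of_bool (\<not> h s > 0) :: real)"
  have U: "integrable M U" "U \<in> borel_measurable N"
    unfolding U_def by (rule integrable_const_bound[of _ 1]) (auto simp: indicator_def)
  have [measurable]: "U \<in> borel_measurable M" using U by simp
  have int_UV: "integrable M (\<lambda>s. of_bool (\<nu> s > c) * U s)"
    by (rule Bochner_Integration.integrable_bound[OF U(1)]) (auto simp: of_bool_def)
  have int_BQ: "integrable M (\<lambda>s. indicator B s * ?Q s)"
    by (rule integrable_const_bound[of _ 1]) (auto simp: indicator_def)
  have int_B: "integrable M (indicator B :: 'a \<Rightarrow> real)"
    by (rule integrable_const_bound[of _ 1]) simp_all
  have int_Bp: "integrable M (\<lambda>s. indicator B s * p s)"
    by (rule Bochner_Integration.integrable_bound[OF int_p])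
      (use int_p in \<open>auto simp: indicator_def\<close>)
  \<comment> \<open>Both sides are the unselected mass of \<open>B\<close>: the states in
    \<open>B\<close> with \<open>h \<le> 0\<close> and \<open>\<nu> \<le> c\<close>. On
    \<open>B\<close> the conditional probability \<open>p\<close> is at least one, so this mass
    cannot be positive.\<close>
  have "(1 - ?q) * (\<integral>s. U s \<partial>M) = (\<integral>s. U s \<partial>M) - (\<integral>s. of_bool (\<nu> s > c) * U s \<partial>M)"
    by (simp add: integral_tail_mult[OF U] left_diff_distrib)
  also have "\<dots> = (\<integral>s. U s - of_bool (\<nu> s > c) * U s \<partial>M)"
    by (rule Bochner_Integration.integral_diff[OF U(1) int_UV, symmetric])
  also have "\<dots> = (\<integral>s. indicator B s - indicator B s * ?Q s \<partial>M)"
    by (auto intro!: Bochner_Integration.integral_cong simp: U_def of_bool_def)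
  also have "\<dots> = (\<integral>s. indicator B s \<partial>M) - (\<integral>s. indicator B s * ?Q s \<partial>M)"
    by (rule Bochner_Integration.integral_diff[OF int_B int_BQ])
  also have "(\<integral>s. indicator B s * ?Q s \<partial>M) = (\<integral>s. indicator B s * p s \<partial>M)"
    unfolding p_def
    by (rule F.real_cond_exp_intg(2)[symmetric, OF int_BQ]) (use BF in auto)
  also have "(\<integral>s. indicator B s \<partial>M) - (\<integral>s. indicator B s * p s \<partial>M) \<le> 0"
  proof -
    have "indicator B s \<le> indicator B s * p s" for s
      by (simp add: B_def indicator_def)
    then show ?thesis
      using integral_mono[OF int_B int_Bp] by (simp only: diff_le_0_iff_le)
  qed
  finally have "(\<integral>s. U s \<partial>M) \<le> 0"
    using tail by (simp add: mult_le_0_iff)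
  moreover have U_nonneg: "U s \<ge> 0" for s
    by (simp add: U_def)
  then have "(\<integral>s. U s \<partial>M) \<ge> 0"
    by simp
  ultimately have "(\<integral>s. U s \<partial>M) = 0"
    by linarith
  then have "AE s in M. U s = 0"
    using U_nonneg by (subst integral_nonneg_eq_0_iff_AE[OF U(1), symmetric]) auto
  then have Bh: "AE s in M. s \<in> B \<longrightarrow> h s > 0"
    by (auto simp: U_def elim!: eventually_mono split: if_splits)

  have int_BZ: "integrable M (\<lambda>s. indicator B s * Z s)"
    by (rule Bochner_Integration.integrable_bound[OF Z(1)]) (auto simp: indicator_def)
  \<comment> \<open>\<open>B\<close> belongs to both \<open>F\<close> and \<open>H\<close>, so over
    \<open>B\<close> the integral of \<open>Z\<close> can be computed through either conditional
    expectation.\<close>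
  have "(\<integral>s. indicator B s * h s \<partial>M) = (\<integral>s. indicator B s * Z s \<partial>M)"
    unfolding h by (rule H.real_cond_exp_intg(2)[OF int_BZ]) (use BH in auto)
  also have "\<dots> = (\<integral>s. indicator B s * real_cond_exp M F Z s \<partial>M)"
    by (rule F.real_cond_exp_intg(2)[symmetric, OF int_BZ]) (use BF in auto)
  also have "\<dots> = 0"
    by (rule integral_eq_zero_AE) (use Z0 in auto)
  finally have "(\<integral>s. indicator B s * h s \<partial>M) = 0" .
  moreover have "integrable M (\<lambda>s. indicator B s * h s)"
    unfolding h by (rule H.real_cond_exp_intg(1)[OF int_BZ]) (use BH in auto)
  moreover have "AE s in M. 0 \<le> indicator B s * h s"
    using Bh by eventually_elim (auto simp: indicator_def)
  ultimately have "AE s in M. indicator B s * h s = 0"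
    by (subst integral_nonneg_eq_0_iff_AE[symmetric]) auto
  with Bh have "AE s in M. s \<notin> B"
    by eventually_elim auto
  with p_pos show ?thesis
    using AE_space by eventually_elim (auto simp: B_def p_def)
qed

end

end

section \<open>Parallel trends as a moment condition\<close>

lemma demeaned_diff:
  assumes "prob_space M" and X: "X \<in> borel_measurable M"
    and Y: "integrable M Y1" "integrable M Y2"
  shows "AE s in M. demeaned M X Y2 s - demeaned M X Y1 s
      = (Y2 s - Y1 s) - cond_E M X (\<lambda>s. Y2 s - Y1 s) s"
proof -
  interpret prob_space M by fact
  interpret F: sigma_finite_subalgebra M "gen_alg M X"
    by (rule sigma_finite_subalgebra_of_subalgebra[OF subalgebra_gen_alg[OF X]])
  show ?thesis
    using F.real_cond_exp_diff[OF Y(2,1)] by (auto simp: demeaned_def cond_E_def)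
qed

text \<open>With \<open>m\<close>, \<open>p\<close> and \<open>a\<close> as defined in the proof,
  the treated trend is \<open>a / p\<close> and the untreated one \<open>(m - a) / (1 - p)\<close>.
  For \<open>p\<close> strictly between 0 and 1, cross-multiplication shows that they agree iff
  \<open>a = m * p\<close>, and \<open>a - m * p\<close> is the conditional mean of the demeaned
  difference on the treated group.\<close>

lemma cond_parallel_trends_iff:
  assumes "prob_space M" and X: "X \<in> borel_measurable M"
    and Y: "integrable M Y1" "integrable M Y2"
    and G [measurable]: "G \<in> measurable M (count_space UNIV)"
    and G01: "AE s in M. G s \<in> {0, 1}"
    and p01: "AE s in M. cond_P M X (\<lambda>s. G s = 1) s \<in> {0<..<1}"
  shows "cond_parallel_trends M X Y1 Y2 G \<longleftrightarrow>
    (AE s in M. cond_E M X (\<lambda>s. of_bool (G s = 1) * (demeaned M X Y2 s - demeaned M X Y1 s)) s = 0)"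
proof -
  interpret prob_space M by fact
  let ?F = "gen_alg M X"
  interpret F: sigma_finite_subalgebra M ?F
    by (rule sigma_finite_subalgebra_of_subalgebra[OF subalgebra_gen_alg[OF X]])
  define D where "D = (\<lambda>s. Y2 s - Y1 s)"
  define m where "m = cond_E M X D"
  define I where "I = (\<lambda>s. of_bool (G s = 1) :: real)"
  define J where "J = (\<lambda>s. of_bool (G s = 0) :: real)"
  define p where "p = cond_P M X (\<lambda>s. G s = 1)"
  define a where "a = cond_E M X (\<lambda>s. I s * D s)"
  define Z where "Z = (\<lambda>s. demeaned M X Y2 s - demeaned M X Y1 s)"
  have D: "integrable M D" using Y by (simp add: D_def)
  then have [measurable]: "D \<in> borel_measurable M" by simp
  have m: "integrable M m" "m \<in> borel_measurable ?F"
    using F.real_cond_exp_int(1)[OF D] by (simp_all add: m_def cond_E_def)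
  then have [measurable]: "m \<in> borel_measurable M" by simp
  have [measurable]: "I \<in> borel_measurable M" "J \<in> borel_measurable M"
    by (simp_all add: I_def J_def)
  have [measurable]: "Z \<in> borel_measurable M"
    using Y by (simp add: Z_def demeaned_def cond_E_def)
  have int_I: "integrable M I"
    unfolding I_def by (rule integrable_const_bound[of _ 1]) auto
  have int_ID: "integrable M (\<lambda>s. I s * D s)"
    by (rule Bochner_Integration.integrable_bound[OF D]) (auto simp: I_def)
  have int_mI: "integrable M (\<lambda>s. m s * I s)"
    by (rule Bochner_Integration.integrable_bound[OF m(1)]) (auto simp: I_def)
  have IJ: "AE s in M. J s = 1 - I s"
    using G01 by eventually_elim (auto simp: I_def J_def)

  have "AE s in M. I s * Z s = I s * D s - m s * I s"
    using demeaned_diff[OF assms(1) X Y]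
    by eventually_elim (simp add: Z_def D_def m_def, simp add: algebra_simps)
  then have "AE s in M. cond_E M X (\<lambda>s. I s * Z s) s = cond_E M X (\<lambda>s. I s * D s - m s * I s) s"
    unfolding cond_E_def by (rule F.real_cond_exp_cong) measurable
  moreover have "AE s in M. cond_E M X (\<lambda>s. I s * D s - m s * I s) s
      = a s - cond_E M X (\<lambda>s. m s * I s) s"
    unfolding cond_E_def a_def by (rule F.real_cond_exp_diff[OF int_ID int_mI])
  \<comment> \<open>The conditional mean \<open>m\<close> is a function of the covariates and can be
    pulled out.\<close>
  moreover have "AE s in M. cond_E M X (\<lambda>s. m s * I s) s = m s * p s"
    unfolding cond_E_def p_def cond_P_def I_def[symmetric]
    by (rule F.real_cond_exp_mult[OF m(2) _ int_mI]) measurable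
  ultimately have 1: "AE s in M. cond_E M X (\<lambda>s. I s * Z s) s = a s - m s * p s"
    by eventually_elim simp

  have "AE s in M. cond_E M X (\<lambda>s. J s * D s) s = cond_E M X (\<lambda>s. D s - I s * D s) s"
    unfolding cond_E_def
    by (rule F.real_cond_exp_cong) (use IJ in \<open>auto simp: left_diff_distrib elim!: eventually_mono\<close>)
  moreover have "AE s in M. cond_E M X (\<lambda>s. D s - I s * D s) s = m s - a s"
    unfolding cond_E_def a_def m_def by (rule F.real_cond_exp_diff[OF D int_ID])
  ultimately have 2: "AE s in M. cond_E M X (\<lambda>s. J s * D s) s = m s - a s"
    by eventually_elim simp

  have "AE s in M. cond_E M X J s = cond_E M X (\<lambda>s. 1 - I s) s"
    unfolding cond_E_def by (rule F.real_cond_exp_cong[OF IJ]) measurable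
  moreover have "AE s in M. cond_E M X (\<lambda>s. 1 - I s) s = cond_E M X (\<lambda>s. 1) s - p s"
    unfolding cond_E_def p_def cond_P_def I_def[symmetric]
    by (rule F.real_cond_exp_diff[OF _ int_I]) simp
  moreover have "AE s in M. cond_E M X (\<lambda>s. 1) s = 1"
    unfolding cond_E_def by (rule F.real_cond_exp_F_meas) simp_all
  ultimately have 3: "AE s in M. cond_P M X (\<lambda>s. G s = 0) s = 1 - p s"
    unfolding cond_P_def J_def[symmetric] by eventually_elim simp

  have "AE s in M. (cond_E_event M G 1 X D s = cond_E_event M G 0 X D s) \<longleftrightarrow>
      cond_E M X (\<lambda>s. I s * Z s) s = 0"
    using 1 2 3 p01[folded p_def]
  proof eventually_elim
    case (elim s)
    have "cond_E_event M G 1 X D s = a s / p s"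
      by (simp add: cond_E_event_def a_def p_def I_def)
    moreover have "cond_E_event M G 0 X D s = (m s - a s) / (1 - p s)"
      using elim by (simp add: cond_E_event_def J_def)
    moreover have "a s / p s = (m s - a s) / (1 - p s) \<longleftrightarrow> a s - m s * p s = 0"
      using elim(4) by (simp add: frac_eq_eq) (auto simp: algebra_simps)
    ultimately show ?case using elim(1) by simp
  qed
  then have "(AE s in M. cond_E_event M G 1 X D s = cond_E_event M G 0 X D s) \<longleftrightarrow>
      (AE s in M. cond_E M X (\<lambda>s. I s * Z s) s = 0)"
    by (rule eventually_subst)
  then show ?thesis
    by (simp add: cond_parallel_trends_def D_def I_def Z_def)
qed

section \<open>Extending selections beyond the supports\<close>

lemma selection_class_measurable:
  assumes g: "g \<in> selection_class M X \<omega> \<nu>"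
  shows "g \<in> measurable borel (count_space UNIV)"
proof -
  let ?S = "rv_support M X \<times> rv_support M \<omega> \<times> rv_support M \<nu>"
  have g_ext: "g \<in> ?S \<rightarrow>\<^sub>E {0, 1}"
    and g_meas: "g \<in> measurable (restrict_space borel ?S) (count_space {0, 1})"
    using g by (simp_all add: selection_class_def Let_def)
  \<comment> \<open>Closed supports have a Borel product, so extending by a constant off
    \<open>?S\<close> keeps measurability.\<close>
  have "?S \<in> sets borel"
    by (intro borel_closed closed_Times closed_rv_support)
  moreover have "g \<in> measurable (restrict_space borel ?S) (count_space UNIV)"
    using measurable_compose[OF g_meas, of "\<lambda>x. x" "count_space UNIV"] by simp
  ultimately have "(\<lambda>y. if y \<in> ?S then g y else undefined) \<in> measurable borel (count_space UNIV)"
    using measurable_restrict_space_iff[of ?S borel undefined "count_space UNIV" g] by simp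
  \<comment> \<open>Members of the class are extensional, so the extension by
    \<open>undefined\<close> is \<open>g\<close> itself.\<close>
  also have "(\<lambda>y. if y \<in> ?S then g y else undefined) = g"
    using PiE_arb[OF g_ext] by (intro ext) simp
  finally show ?thesis .
qed

text \<open>Supplies members of the class: the selection that proves necessity is given by a Borel
  set of values of covariates, unobservables and \<open>\<nu>\<close>.\<close>

lemma restrict_in_selection_class:
  assumes "C \<in> sets borel"
  shows "restrict (\<lambda>y. of_bool (y \<in> C)) (rv_support M X \<times> rv_support M \<omega> \<times> rv_support M \<nu>)
    \<in> selection_class M X \<omega> \<nu>"
proof -
  let ?S = "rv_support M X \<times> rv_support M \<omega> \<times> rv_support M \<nu>"
  have "(\<lambda>y. of_bool (y \<in> C)) \<in> measurable borel (count_space {0, 1 :: nat})"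
    unfolding of_bool_def by (rule measurable_If) (use assms in auto)
  then have "(\<lambda>y. of_bool (y \<in> C)) \<in> measurable (restrict_space borel ?S) (count_space {0, 1 :: nat})"
    by (rule measurable_restrict_space1)
  then have "restrict (\<lambda>y. of_bool (y \<in> C)) ?S \<in> measurable (restrict_space borel ?S) (count_space {0, 1 :: nat})"
    by (rule measurable_cong[THEN iffD1, rotated]) (simp add: space_restrict_space)
  then show ?thesis
    by (auto simp: selection_class_def Let_def)
qed

theorem theoremD1:
  fixes M :: "'a measure"
    and X1 X2 :: "'a \<Rightarrow> 'x::euclidean_space"
    and \<alpha> :: "'a \<Rightarrow> 'al::euclidean_space"
    and \<epsilon>1 \<epsilon>2 :: "'a \<Rightarrow> 'ep::euclidean_space"
    and \<mu> :: "'a \<Rightarrow> 'm::euclidean_space"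
    and \<eta>1 \<eta>2 :: "'a \<Rightarrow> 'h::euclidean_space"
    and \<nu> :: "'a \<Rightarrow> real"
    and \<xi>1 \<xi>2 :: "'x \<times> 'al \<times> 'ep \<Rightarrow> real"
    and Y1 Y2 :: "'a \<Rightarrow> real"
    and w :: "'al \<times> 'ep \<times> 'ep \<times> 'm \<times> 'h \<times> 'h \<Rightarrow> 'o::euclidean_space"
    and X :: "'a \<Rightarrow> 'x \<times> 'x"
    and \<omega> :: "'a \<Rightarrow> 'o"
  assumes M: "prob_space M"
    and rvs: "X1 \<in> borel_measurable M" "X2 \<in> borel_measurable M"
      "\<alpha> \<in> borel_measurable M" "\<epsilon>1 \<in> borel_measurable M" "\<epsilon>2 \<in> borel_measurable M"
      "\<mu> \<in> borel_measurable M" "\<eta>1 \<in> borel_measurable M" "\<eta>2 \<in> borel_measurable M"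
      "\<nu> \<in> borel_measurable M"
    and X: "X = (\<lambda>s. (X1 s, X2 s))"
    and xi: "\<xi>1 \<in> borel_measurable borel" "\<xi>2 \<in> borel_measurable borel"
    and Y1: "Y1 = (\<lambda>s. \<xi>1 (X1 s, \<alpha> s, \<epsilon>1 s))"
    and Y2: "Y2 = (\<lambda>s. \<xi>2 (X2 s, \<alpha> s, \<epsilon>2 s))"
    and Y_integrable: "integrable M Y1" "integrable M Y2"
    and w: "w \<in> borel_measurable borel"
    and omega: "\<omega> = (\<lambda>s. w (\<alpha> s, \<epsilon>1 s, \<epsilon>2 s, \<mu> s, \<eta>1 s, \<eta>2 s))"
    and nu_nondegenerate: "\<exists>c::real. AE s in M. cond_P M X (\<lambda>s'. \<nu> s' > c) s \<in> {0<..<1}"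
    and nu_indep: "independent_rvs M \<nu> (\<lambda>s. (X s, \<alpha> s, \<epsilon>1 s, \<epsilon>2 s, \<mu> s, \<eta>1 s, \<eta>2 s))"
    and sign:
      "measure M {s \<in> space M. cond_E M (\<lambda>s'. (\<omega> s', X s'))
          (\<lambda>s'. demeaned M X Y2 s' - demeaned M X Y1 s') s > 0} < 1
       \<or> measure M {s \<in> space M. cond_E M (\<lambda>s'. (\<omega> s', X s'))
          (\<lambda>s'. demeaned M X Y2 s' - demeaned M X Y1 s') s < 0} < 1"
  shows "(\<forall>g \<in> selection_class M X \<omega> \<nu>.
            (let G = (\<lambda>s. g (X s, \<omega> s, \<nu> s))
             in (AE s in M. cond_P M X (\<lambda>s'. G s' = 1) s \<in> {0<..<1})
                \<longrightarrow> cond_parallel_trends M X Y1 Y2 G))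
     \<longleftrightarrow> (AE s in M. cond_E M (\<lambda>s'. (\<omega> s', X s'))
            (\<lambda>s'. demeaned M X Y2 s' - demeaned M X Y1 s') s = 0)"
proof -

  \<comment> \<open>Setup: the sigma-algebras and the measurability of all variables\<close>
  interpret prob_space M by fact
  \<comment> \<open>\<open>W\<close> is the vector from which \<open>\<nu>\<close> is assumed
    independent, so \<open>N\<close> is the subalgebra for the Fubini argument. \<open>H\<close>
    carries \<open>(\<omega>, X)\<close> and \<open>F\<close> carries \<open>X\<close>, giving a
    chain from \<open>F\<close> through \<open>H\<close> to \<open>N\<close>.\<close>
  define W where "W = (\<lambda>s. (X s, \<alpha> s, \<epsilon>1 s, \<epsilon>2 s, \<mu> s, \<eta>1 s, \<eta>2 s))"
  define N where "N = gen_alg M W"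
  define H where "H = gen_alg M (\<lambda>s. (\<omega> s, X s))"
  define F where "F = gen_alg M X"
  define Z where "Z = (\<lambda>s. demeaned M X Y2 s - demeaned M X Y1 s)"
  define h where "h = real_cond_exp M H Z"
  let ?S = "rv_support M X \<times> rv_support M \<omega> \<times> rv_support M \<nu>"

  have XM: "X \<in> borel_measurable M"
    unfolding X by (intro borel_measurable_Pair rvs)
  have \<omega>M: "\<omega> \<in> borel_measurable M"
    unfolding omega by (rule measurable_compose[OF _ w]) (intro borel_measurable_Pair rvs)
  have WM: "W \<in> borel_measurable M"
    unfolding W_def by (intro borel_measurable_Pair rvs XM)
  have WN: "W \<in> borel_measurable N"
    unfolding N_def by (rule gen_alg_measurable)
  \<comment> \<open>Peeling the tuple from the left: the first facts of \<open>W0\<close>,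
    \<open>W1\<close>, \<open>W2\<close>, \<open>W3\<close> concern \<open>X\<close>,
    \<open>\<alpha>\<close>, \<open>\<epsilon>1\<close>, \<open>\<epsilon>2\<close>, and the second
    fact of \<open>W0\<close> concerns the whole argument of \<open>w\<close>.\<close>
  note W0 = borel_measurable_PairD[OF WN[unfolded W_def], unfolded fst_conv snd_conv]
  note W1 = borel_measurable_PairD[OF W0(2), unfolded fst_conv snd_conv]
  note W2 = borel_measurable_PairD[OF W1(2), unfolded fst_conv snd_conv]
  note W3 = borel_measurable_PairD[OF W2(2), unfolded fst_conv snd_conv]
  note XN = W0(1)
  note X12N = borel_measurable_PairD[OF XN[unfolded X], unfolded fst_conv snd_conv]
  have \<omega>N: "\<omega> \<in> borel_measurable N"
    unfolding omega by (rule measurable_compose[OF W0(2) w])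
  have Y1N: "Y1 \<in> borel_measurable N"
    unfolding Y1
    by (rule measurable_compose[OF _ xi(1)]) (intro borel_measurable_Pair X12N W1(1) W2(1))
  have Y2N: "Y2 \<in> borel_measurable N"
    unfolding Y2
    by (rule measurable_compose[OF _ xi(2)]) (intro borel_measurable_Pair X12N W1(1) W3(1))
  have \<omega>XH: "(\<lambda>s. (\<omega> s, X s)) \<in> borel_measurable H"
    unfolding H_def by (rule gen_alg_measurable)
  note H0 = borel_measurable_PairD[OF \<omega>XH, unfolded fst_conv snd_conv]

  have subs: "subalgebra M N" "subalgebra M F" "subalgebra M H"
    unfolding N_def F_def H_def
    by (intro subalgebra_gen_alg borel_measurable_Pair WM XM \<omega>M)+
  have NH: "subalgebra N H" and NF: "subalgebra N F"
    unfolding N_def H_def F_def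
    by (intro subalgebra_gen_alg_mono borel_measurable_Pair XN[unfolded N_def] \<omega>N[unfolded N_def])+
  have HF: "subalgebra H F"
    unfolding H_def F_def by (intro subalgebra_gen_alg_mono H0(2)[unfolded H_def])
  interpret H: sigma_finite_subalgebra M H
    by (rule sigma_finite_subalgebra_of_subalgebra[OF subs(3)])
  interpret F: sigma_finite_subalgebra M F
    by (rule sigma_finite_subalgebra_of_subalgebra[OF subs(2)])

  interpret independent_of_subalgebra M N \<nu>
  proof
    fix A and B :: "real set"
    assume A: "A \<in> sets N" and B: "B \<in> sets borel"
    have "prob ((\<nu> -` B \<inter> space M) \<inter> A) = prob (\<nu> -` B \<inter> space M) * prob A"
      using A[unfolded N_def W_def] in_vimage_algebra[OF B]
      by (intro indep_setD[OF nu_indep[unfolded independent_rvs_def]])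
    then show "prob (A \<inter> (\<nu> -` B \<inter> space M)) = prob A * prob (\<nu> -` B \<inter> space M)"
      by (simp only: Int_commute mult.commute)
  qed (use subs rvs in auto)

  \<comment> \<open>The demeaned difference and its conditional mean\<close>
  have cond_E_Y: "integrable M (cond_E M X Y1)" "integrable M (cond_E M X Y2)"
    using F.real_cond_exp_int(1) Y_integrable by (auto simp: cond_E_def F_def)
  then have Z: "integrable M Z"
    using Y_integrable by (simp add: Z_def demeaned_def)
  have "cond_E M X Y1 \<in> borel_measurable N" "cond_E M X Y2 \<in> borel_measurable N"
    using measurable_from_subalg[OF NF borel_measurable_cond_exp]
    by (simp_all add: cond_E_def F_def)
  then have ZN: "Z \<in> borel_measurable N"
    using Y1N Y2N by (simp add: Z_def demeaned_def)
  have Z0: "AE s in M. real_cond_exp M F Z s = 0"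
  proof -
    \<comment> \<open>The conditional mean given \<open>X\<close> is already
      \<open>X\<close>-measurable, so conditioning again leaves it fixed and the two terms
      cancel.\<close>
    have dem: "AE s in M. real_cond_exp M F (demeaned M X Y) s = 0" if "integrable M Y" for Y
    proof -
      have "integrable M (cond_E M X Y)" "cond_E M X Y \<in> borel_measurable F"
        using F.real_cond_exp_int(1)[OF that] by (auto simp: cond_E_def F_def)
      then have "AE s in M. real_cond_exp M F (cond_E M X Y) s = cond_E M X Y s"
        and "AE s in M. real_cond_exp M F (demeaned M X Y) s
          = real_cond_exp M F Y s - real_cond_exp M F (cond_E M X Y) s"
        unfolding demeaned_def using that by (auto intro: F.real_cond_exp_F_meas F.real_cond_exp_diff)
      then show ?thesis
        by eventually_elim (simp add: cond_E_def F_def)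
    qed
    have "AE s in M. real_cond_exp M F Z s
        = real_cond_exp M F (demeaned M X Y2) s - real_cond_exp M F (demeaned M X Y1) s"
      unfolding Z_def using Y_integrable cond_E_Y
      by (intro F.real_cond_exp_diff) (simp_all add: demeaned_def)
    with dem[OF Y_integrable(1)] dem[OF Y_integrable(2)] show ?thesis
      by eventually_elim simp
  qed
  then have Z_mean: "(\<integral>s. Z s \<partial>M) = 0"
    by (subst F.real_cond_exp_int(2)[OF Z, symmetric]) (rule integral_eq_zero_AE)

  \<comment> \<open>Treatment groups arising from selections\<close>
  have G_measurable: "(\<lambda>s. g (X s, \<omega> s, \<nu> s)) \<in> measurable M (count_space UNIV)"
    if "g \<in> selection_class M X \<omega> \<nu>" for g
    by (rule measurable_compose[OF _ selection_class_measurable[OF that]])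
      (intro borel_measurable_Pair XM \<omega>M rvs)
  \<comment> \<open>Off the supports a selection has the unspecified value \<open>undefined\<close>,
    so membership of the treatment in \<open>{0, 1}\<close> is available only almost surely.\<close>
  have in_support: "AE s in M. (X s, \<omega> s, \<nu> s) \<in> ?S"
    using AE_in_rv_support[OF M XM] AE_in_rv_support[OF M \<omega>M] AE_in_rv_support[OF M rvs(9)]
    by eventually_elim auto
  have G01: "AE s in M. g (X s, \<omega> s, \<nu> s) \<in> {0, 1}"
    if "g \<in> selection_class M X \<omega> \<nu>" for g
  proof -
    have "g \<in> ?S \<rightarrow>\<^sub>E {0, 1}"
      using that by (simp add: selection_class_def Let_def)
    then show ?thesis
      by (rule eventually_mono[OF in_support PiE_mem])
  qed
  have trends_iff: "cond_parallel_trends M X Y1 Y2 (\<lambda>s. g (X s, \<omega> s, \<nu> s)) \<longleftrightarrow>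
      (AE s in M. real_cond_exp M F (\<lambda>s. of_bool (g (X s, \<omega> s, \<nu> s) = 1) * Z s) s = 0)"
    if "g \<in> selection_class M X \<omega> \<nu>"
      "AE s in M. cond_P M X (\<lambda>s'. g (X s', \<omega> s', \<nu> s') = 1) s \<in> {0<..<1}" for g
    using cond_parallel_trends_iff[OF M XM Y_integrable G_measurable[OF that(1)] G01[OF that(1)] that(2)]
    by (simp add: cond_E_def F_def Z_def)

  show ?thesis
    unfolding cond_E_def H_def[symmetric] Z_def[symmetric] h_def[symmetric] Let_def
  proof (intro iffI ballI impI)

    \<comment> \<open>A vanishing conditional mean implies parallel trends\<close>
    fix g
    assume h0: "AE s in M. h s = 0" and g: "g \<in> selection_class M X \<omega> \<nu>"
      and p01: "AE s in M. cond_P M X (\<lambda>s'. g (X s', \<omega> s', \<nu> s') = 1) s \<in> {0<..<1}"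
    \<comment> \<open>The event \<open>G = 1\<close> with \<open>\<nu>\<close> turned into a free
      coordinate. The state then enters only through \<open>X\<close> and \<open>\<omega>\<close>,
      so \<open>T\<close> lies in the product of \<open>H\<close> with the Borel sets.\<close>
    define T where "T = (\<lambda>p. (X (fst p), \<omega> (fst p), snd p)) -` (g -` {1})
        \<inter> space (H \<Otimes>\<^sub>M (borel :: real measure))"
    have "(\<lambda>p. (X (fst p), \<omega> (fst p), snd p)) \<in> borel_measurable (H \<Otimes>\<^sub>M (borel :: real measure))"
      by (intro borel_measurable_Pair measurable_compose[OF measurable_fst H0(1)]
          measurable_compose[OF measurable_fst H0(2)] measurable_snd)
    moreover have "g -` {1} \<in> sets borel"
      using measurable_sets[OF selection_class_measurable[OF g], of "{1}"] by simp
    ultimately have "T \<in> sets (H \<Otimes>\<^sub>M borel)"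
      unfolding T_def by (rule measurable_sets)
    from cond_exp_selected_eq_0[OF HF NH Z ZN h0[unfolded h_def] this]
    have "AE s in M. real_cond_exp M F (\<lambda>s. indicator T (s, \<nu> s) * Z s) s = 0" .
    moreover have "AE s in M. real_cond_exp M F (\<lambda>s. of_bool (g (X s, \<omega> s, \<nu> s) = 1) * Z s) s
        = real_cond_exp M F (\<lambda>s. indicator T (s, \<nu> s) * Z s) s"
    proof (rule F.real_cond_exp_cong)
      \<comment> \<open>Substituting \<open>\<nu> s\<close> for the free coordinate gives back the
        original event.\<close>
      have T_eq: "of_bool (g (X s, \<omega> s, \<nu> s) = 1) * Z s = indicator T (s, \<nu> s) * Z s"
        if "s \<in> space M" for s
        using that subs(3) by (simp add: T_def space_pair_measure subalgebra_def indicator_def)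
      then show "AE s in M. of_bool (g (X s, \<omega> s, \<nu> s) = 1) * Z s = indicator T (s, \<nu> s) * Z s"
        by (rule AE_I2)
      show Q: "(\<lambda>s. of_bool (g (X s, \<omega> s, \<nu> s) = 1) * Z s) \<in> borel_measurable M"
        using G_measurable[OF g] borel_measurable_integrable[OF Z] by measurable
      show "(\<lambda>s. indicator T (s, \<nu> s) * Z s) \<in> borel_measurable M"
        by (rule measurable_cong[THEN iffD1, OF T_eq Q])
    qed
    ultimately have "AE s in M. real_cond_exp M F (\<lambda>s. of_bool (g (X s, \<omega> s, \<nu> s) = 1) * Z s) s = 0"
      by eventually_elim simp
    then show "cond_parallel_trends M X Y1 Y2 (\<lambda>s. g (X s, \<omega> s, \<nu> s))"
      using trends_iff[OF g p01] by simp
  next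

    \<comment> \<open>Parallel trends force a vanishing conditional mean\<close>
    assume trends: "\<forall>g\<in>selection_class M X \<omega> \<nu>.
        (AE s in M. cond_P M X (\<lambda>s'. g (X s', \<omega> s', \<nu> s') = 1) s \<in> {0<..<1}) \<longrightarrow>
        cond_parallel_trends M X Y1 Y2 (\<lambda>s. g (X s, \<omega> s, \<nu> s))"
    obtain c where c: "AE s in M. cond_P M X (\<lambda>s'. \<nu> s' > c) s \<in> {0<..<1}"
      using nu_nondegenerate by blast
    let ?tail = "\<lambda>s. of_bool (\<nu> s > c) :: real"
    have \<nu>c [measurable]: "Measurable.pred M (\<lambda>s. \<nu> s > c)"
      using rvs(9) by measurable
    have int_tail: "integrable M ?tail"
      by (rule integrable_const_bound[of _ 1]) auto
    have c': "AE s in M. real_cond_exp M F ?tail s \<in> {0<..<1}"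
      using c by (simp add: cond_P_def cond_E_def F_def)
    \<comment> \<open>The hypothesis bounds the tail conditionally on \<open>X\<close>; averaging it
      gives the unconditional bound, strict because the conditional probability is below one almost
      surely.\<close>
    have "prob {s \<in> space M. \<nu> s > c} = (\<integral>s. ?tail s \<partial>M)"
    proof -
      have "(\<integral>s. ?tail s \<partial>M) = (\<integral>s. indicator {s \<in> space M. \<nu> s > c} s \<partial>M)"
        by (rule Bochner_Integration.integral_cong) (auto simp: indicator_def)
      then show ?thesis by simp
    qed
    also have "\<dots> = (\<integral>s. real_cond_exp M F ?tail s \<partial>M)"
      by (rule F.real_cond_exp_int(2)[OF int_tail, symmetric])
    also have "\<dots> < 1"
    proof -
      have "0 < (\<integral>s. 1 - real_cond_exp M F ?tail s \<partial>M)"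
      proof (rule integral_less_AE_space[of "\<lambda>_. 0", simplified])
      qed (use c' F.real_cond_exp_int(1)[OF int_tail] emeasure_space_1 in \<open>auto elim!: eventually_mono\<close>)
      then show ?thesis
        using F.real_cond_exp_int(1)[OF int_tail] by (simp add: prob_space)
    qed
    finally have tail: "prob {s \<in> space M. \<nu> s > c} < 1" .

    have "h -` {0<..} \<inter> space H \<in> sets H"
      unfolding h_def by measurable
    \<comment> \<open>A selection must be a function of values, whereas \<open>h\<close> is a
      function of states. As \<open>h\<close> is measurable for the sigma-algebra of
      \<open>(\<omega>, X)\<close>, the event \<open>h > 0\<close> is the preimage of a Borel set
      \<open>K\<close> of such values.\<close>
    then obtain K where K: "K \<in> sets borel"
      "h -` {0<..} \<inter> space M = (\<lambda>s. (\<omega> s, X s)) -` K \<inter> space M"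
      by (auto simp: H_def sets_vimage_algebra2)
    \<comment> \<open>\<open>K\<close> reads \<open>(\<omega>, X)\<close> whereas selections read
      \<open>(X, \<omega>, \<nu>)\<close>, hence the swap of \<open>x\<close> and
      \<open>y\<close>.\<close>
    define C where "C = {(x, y, v). (y, x) \<in> K \<or> v > c}"
    have "C \<in> sets borel"
    proof -
      have id: "(\<lambda>p :: ('x \<times> 'x) \<times> 'o \<times> real. p) \<in> borel_measurable borel"
        by simp
      note p1 = borel_measurable_PairD[OF id]
      note p2 = borel_measurable_PairD[OF p1(2)]
      have "C = (\<lambda>p. (fst (snd p), fst p)) -` K \<union> (\<lambda>p. snd (snd p)) -` {c<..}"
        by (auto simp: C_def)
      moreover have "(\<lambda>p :: ('x \<times> 'x) \<times> 'o \<times> real. (fst (snd p), fst p)) -` K \<in> sets borel"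
        using measurable_sets[OF borel_measurable_Pair[OF p2(1) p1(1)] K(1)] by simp
      moreover have "(\<lambda>p :: ('x \<times> 'x) \<times> 'o \<times> real. snd (snd p)) -` {c<..} \<in> sets borel"
        using measurable_sets[OF p2(2), of "{c<..}"] by simp
      ultimately show ?thesis by (simp only: sets.Un)
    qed
    define g where "g = (restrict (\<lambda>y. of_bool (y \<in> C)) ?S :: _ \<Rightarrow> nat)"
    have g: "g \<in> selection_class M X \<omega> \<nu>"
      unfolding g_def by (rule restrict_in_selection_class) fact
    \<comment> \<open>The restriction in \<open>g\<close> matters only off the supports, which is a
      null event.\<close>
    have gQ: "AE s in M. g (X s, \<omega> s, \<nu> s) = 1 \<longleftrightarrow> h s > 0 \<or> \<nu> s > c"
      using in_support AE_space
    proof eventually_elim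
      case (elim s)
      then have "(\<omega> s, X s) \<in> K \<longleftrightarrow> h s > 0" using K(2) by blast
      then show ?case using elim(1) by (auto simp: g_def C_def)
    qed
    have [measurable]: "h \<in> borel_measurable M" by (simp add: h_def)
    have [measurable]: "Measurable.pred M (\<lambda>s. g (X s, \<omega> s, \<nu> s) = 1)"
      using G_measurable[OF g] by measurable
    have [measurable]: "Z \<in> borel_measurable M" using Z by simp
    have "AE s in M. cond_P M X (\<lambda>s'. g (X s', \<omega> s', \<nu> s') = 1) s
        = real_cond_exp M F (\<lambda>s. of_bool (h s > 0 \<or> \<nu> s > c)) s"
      unfolding cond_P_def cond_E_def F_def[symmetric]
      by (rule F.real_cond_exp_cong, rule eventually_mono[OF gQ], simp) measurable
    moreover have "AE s in M. real_cond_exp M F (\<lambda>s. of_bool (h s > 0 \<or> \<nu> s > c)) s \<in> {0<..<1}"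
      using c' by (intro cond_prob_selection_strict[OF NH Z ZN h_def tail HF Z0])
        (auto elim!: eventually_mono)
    ultimately have p01: "AE s in M. cond_P M X (\<lambda>s'. g (X s', \<omega> s', \<nu> s') = 1) s \<in> {0<..<1}"
      by eventually_elim simp
    have int_gZ: "integrable M (\<lambda>s. of_bool (g (X s, \<omega> s, \<nu> s) = 1) * Z s)"
    proof (rule Bochner_Integration.integrable_bound[OF Z])
      show "(\<lambda>s. of_bool (g (X s, \<omega> s, \<nu> s) = 1) * Z s) \<in> borel_measurable M"
        by measurable
    qed (simp add: of_bool_def)
    have "AE s in M. real_cond_exp M F (\<lambda>s. of_bool (g (X s, \<omega> s, \<nu> s) = 1) * Z s) s = 0"
      using trends g p01 trends_iff[OF g p01] by blast
    \<comment> \<open>Only the average over the covariates of the conditional moment is needed from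
      here on.\<close>
    then have "(\<integral>s. of_bool (g (X s, \<omega> s, \<nu> s) = 1) * Z s \<partial>M) = 0"
      by (subst F.real_cond_exp_int(2)[OF int_gZ, symmetric]) (rule integral_eq_zero_AE)
    also have "(\<integral>s. of_bool (g (X s, \<omega> s, \<nu> s) = 1) * Z s \<partial>M)
        = (\<integral>s. of_bool (h s > 0 \<or> \<nu> s > c) * Z s \<partial>M)"
      by (rule integral_cong_AE, measurable, rule eventually_mono[OF gQ]) simp
    finally show "AE s in M. h s = 0"
      by (rule cond_exp_eq_0_if_selected_mean_0[OF NH Z ZN h_def tail Z_mean])
  qed
qed

end
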